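(* Let $N = pquv$ where $p,q,u,v$ are pairwise coprime positive integers. Put $r_1 = pu$, $s_1 = qv$, $r_2 = pv$, $s_2 = qu$, and consider the cusps $1/r_1$ and $1/r_2$ of $\Gamma=\Gamma_0(N)$ with the scaling matrices $\sigma_{1/r_1}$, $\sigma_{1/r_2}$ specified in the context. The set of allowed moduli for the pair of cusps $1/r_1,1/r_2$ is $$\mathcal{C}_{1/r_1,1/r_2} = \left\{\gamma = c\sqrt{uv} > 0 : c \equiv 0 \pmod{pq},\ (c,uv)=1\right\}$$ (with $c$ an integer). Let $\chi$ be an even Dirichlet character modulo $N$, and factor it as $\chi = \chi_p\chi_q\chi_u\chi_v$ where $\chi_p$ is a character modulo $p$, $\chi_q$ a character modulo $q$, $\chi_u$ a character modulo $u$, and $\chi_v$ a character modulo $v$. For all integers $m,n$ and every $\gamma = c\sqrt{uv}\in\mathcal{C}_{1/r_1,1/r_2}$, the Kloosterman sum for this pair of cusps and character $\chi$ is $$S_{1/r_1,1/r_2}(m,n;c\sqrt{uv};\chi) = \mathfrak{f}\;\overline{\chi_u}(c)\,\chi_v(c)\sum_{\substack{a,d \ (\mathrm{mod}\ c)\\ ad\equiv 1\ (\mathrm{mod}\ c)}} \overline{\chi_p}(d)\,\overline{\chi_q}(a)\, e\!\left(\frac{a\,\overline{uv}\,m + dn}{c}\right),$$ where $\overline{uv}$ denotes an inverse of $uv$ modulo $c$, and $$\mathfrak{f} = \mathfrak{f}(p,q,u,v,\chi) = \chi_v(-1)\,\overline{\chi_p\chi_v}(u)\,(\chi_q\chi_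u)(v)\,\chi_u(pq)\,\overline{\chi_v}(pq).$$
   Context: $(\cdot,\cdot)$ denotes the gcd and $e(x)=e^{2\pi i x}$. $\Gamma=\Gamma_0(N)\subset \mathrm{SL}_2(\mathbb{Z})$, and $\Gamma_\infty = \{\pm\begin{pmatrix}1&n\\0&1\end{pmatrix}: n\in\mathbb{Z}\}$. A Dirichlet character $\chi$ modulo $N$ is extended to $\Gamma$ by $\chi\begin{pmatrix}a&b\\ N c&d\end{pmatrix}=\chi(d)$; $\chi$ is even if $\chi(-1)=1$. A scaling matrix for a cusp $\mathfrak{a}$ is $\sigma_{\mathfrak a}\in\mathrm{SL}_2(\mathbb{R})$ with $\sigma_{\mathfrak a}\infty=\mathfrak a$ and $\sigma_{\mathfrak a}^{-1}\Gamma_{\mathfrak a}\sigma_{\mathfrak a}=\Gamma_\infty$, where $\Gamma_{\mathfrak a}$ is the stabilizer of $\mathfrak a$ in $\Gamma$. For a factorization $N=rs$ with $(r,s)=1$, the cusp $1/r$ (an Atkin–Lehner cusp) is given the scaling matrix $$\sigma_{1/r}=\tau_r\nu_s,\qquad \tau_r=\begin{pmatrix}1&(\overline{s}s-1)/r\\ r&\overline{s}s\end{pmatrix},\qquad \nu_s=\begin{pmatrix}\sqrt{s}&0\\0&1/\sqrt{s}\end{pmatrix},$$ where $\overline{s}$ is any integer with $s\overline{s}\equiv1\pmod r$. (For $r_1=pu$ the complementary divisor is $s_1=qv$; for $r_2=pv$ it is $s_2=qu$.) Every even $\chi$ modulo $N$ is singular at every Atkin–Lehner cusp, i.e. $\chi(\lambda_{\mathfrak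 a})=1$, where $\lambda_{\mathfrak a}\in\Gamma$ is defined by $\sigma_{\mathfrak a}^{-1}\lambda_{\mathfrak a}\sigma_{\mathfrak a}=\begin{pmatrix}1&1\\0&1\end{pmatrix}$. For cusps $\mathfrak a,\mathfrak b$ with chosen scaling matrices, the set of allowed moduli is $$\mathcal{C}_{\mathfrak a\mathfrak b}=\left\{\gamma>0:\ \begin{pmatrix}*&*\\ \gamma&*\end{pmatrix}\in\sigma_{\mathfrak a}^{-1}\Gamma\sigma_{\mathfrak b}\right\}.$$ For cusps $\mathfrak a,\mathfrak b$ singular for $\chi$ and $\gamma_0\in\mathcal{C}_{\mathfrak a\mathfrak b}$, the Kloosterman sum of modulus $\gamma_0$ is $$S_{\mathfrak a\mathfrak b}(m,n;\gamma_0;\chi)=\sum_{\rho}\overline{\chi(\sigma_{\mathfrak a}\rho\,\sigma_{\mathfrak b}^{-1})}\;e\!\left(\frac{\alpha m+\delta n}{\gamma_0}\right),$$ where $\rho=\begin{pmatrix}\alpha&\beta\\ \gamma_0&\delta\end{pmatrix}$ runs over representatives of those double cosets in $\Gamma_\infty\backslash\sigma_{\mathfrak a}^{-1}\Gamma\sigma_{\mathfrak b}/\Gamma_\infty$ having lower-left entry $\gamma_0$. *)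

theory Defs
  imports "HOL-Analysis.Analysis" "HOL-Number_Theory.Cong"
begin

definition e :: "real \<Rightarrow> complex" where
  "e x = exp (2 * of_real pi * \<i> * of_real x)"

text \<open>For \<open>N = 1\<close> this forces the constant function 1 (so in particular the value 1 at 0).\<close>

definition dirichlet_character :: "int \<Rightarrow> (int \<Rightarrow> complex) \<Rightarrow> bool" where
  "dirichlet_character N chi \<longleftrightarrow>
     (\<forall>a b. chi (a * b) = chi a * chi b) \<and>
     (\<forall>a. chi (a + N) = chi a) \<and>
     (\<forall>a. chi a \<noteq> 0 \<longleftrightarrow> coprime a N)"

definition even_character :: "(int \<Rightarrow> complex) \<Rightarrow> bool" where
  "even_character chi \<longleftrightarrow> chi (- 1) = 1"

definition mat2 :: "real \<Rightarrow> real \<Rightarrow> real \<Rightarrow> real \<Rightarrow> real ^ 2 ^ 2" where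
  "mat2 a b c d = vector [vector [a, b], vector [c, d]]"

text \<open>
  Scaling matrices have irrational entries, so the discrete groups are taken as sets of real
  matrices.
\<close>

definition Gamma0 :: "int \<Rightarrow> (real ^ 2 ^ 2) set" where
  "Gamma0 N = {mat2 (of_int a) (of_int b) (of_int (N * c)) (of_int d) | a b c d.
                 a * d - b * (N * c) = 1}"

definition Gamma_inf :: "(real ^ 2 ^ 2) set" where
  "Gamma_inf = (\<Union>n::int. {mat2 1 (of_int n) 0 1, - mat2 1 (of_int n) 0 1})"

text \<open>
  The extension of a character to the group; only used on matrices with integer entries, where
  the floor is exact.
\<close>

definition char_mat :: "(int \<Rightarrow> complex) \<Rightarrow> real ^ 2 ^ 2 \<Rightarrow> complex" where
  "char_mat chi M = chi \<lfloor>M $ 2 $ 2\<rfloor>"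

text \<open>
  The scaling matrix \<open>\<tau>\<^sub>r \<nu>\<^sub>s\<close> of the cusp \<open>1/r\<close>, where \<open>r s\<close> is the level; \<open>sbar\<close> is meant
  to be an inverse of \<open>s\<close> modulo \<open>r\<close>, in which case the upper right entry of \<open>\<tau>\<^sub>r\<close> is an
  integer.
\<close>

definition tau_mat :: "int \<Rightarrow> int \<Rightarrow> int \<Rightarrow> real ^ 2 ^ 2" where
  "tau_mat r s sbar =
     mat2 1 (real_of_int (sbar * s - 1) / real_of_int r) (real_of_int r) (real_of_int (sbar * s))"

definition nu_mat :: "int \<Rightarrow> real ^ 2 ^ 2" where
  "nu_mat s = mat2 (sqrt (real_of_int s)) 0 0 (1 / sqrt (real_of_int s))"

definition scaling_mat :: "int \<Rightarrow> int \<Rightarrow> int \<Rightarrow> real ^ 2 ^ 2" where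
  "scaling_mat r s sbar = tau_mat r s sbar ** nu_mat s"

text \<open>In the following, a cusp enters only through its scaling matrix.\<close>

definition conj_Gamma0 :: "int \<Rightarrow> real ^ 2 ^ 2 \<Rightarrow> real ^ 2 ^ 2 \<Rightarrow> (real ^ 2 ^ 2) set" where
  "conj_Gamma0 N \<sigma>a \<sigma>b = {matrix_inv \<sigma>a ** g ** \<sigma>b | g. g \<in> Gamma0 N}"

definition allowed_moduli :: "int \<Rightarrow> real ^ 2 ^ 2 \<Rightarrow> real ^ 2 ^ 2 \<Rightarrow> real set" where
  "allowed_moduli N \<sigma>a \<sigma>b = {\<gamma>. \<gamma> > 0 \<and> (\<exists>\<rho> \<in> conj_Gamma0 N \<sigma>a \<sigma>b. \<rho> $ 2 $ 1 = \<gamma>)}"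

definition Gamma_inf_double_coset :: "real ^ 2 ^ 2 \<Rightarrow> (real ^ 2 ^ 2) set" where
  "Gamma_inf_double_coset \<rho> = {A ** \<rho> ** B | A B. A \<in> Gamma_inf \<and> B \<in> Gamma_inf}"

text \<open>
  The double cosets having a representative with lower left entry \<open>\<gamma>\<close>. Since minus the identity
  lies in \<open>Gamma_inf\<close>, such a coset also contains matrices with lower left entry \<open>- \<gamma>\<close>; the
  representatives used in the Kloosterman sum are those with entry \<open>\<gamma>\<close>.
\<close>

definition double_cosets_of_modulus ::
  "int \<Rightarrow> real ^ 2 ^ 2 \<Rightarrow> real ^ 2 ^ 2 \<Rightarrow> real \<Rightarrow> (real ^ 2 ^ 2) set set" where
  "double_cosets_of_modulus N \<sigma>a \<sigma>b \<gamma> =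
     {Gamma_inf_double_coset \<rho> | \<rho>. \<rho> \<in> conj_Gamma0 N \<sigma>a \<sigma>b \<and> \<rho> $ 2 $ 1 = \<gamma>}"

definition kloosterman_term ::
  "real ^ 2 ^ 2 \<Rightarrow> real ^ 2 ^ 2 \<Rightarrow> (int \<Rightarrow> complex) \<Rightarrow> int \<Rightarrow> int \<Rightarrow> real ^ 2 ^ 2 \<Rightarrow> complex" where
  "kloosterman_term \<sigma>a \<sigma>b chi m n \<rho> =
     cnj (char_mat chi (\<sigma>a ** \<rho> ** matrix_inv \<sigma>b)) *
     e ((\<rho> $ 1 $ 1 * of_int m + \<rho> $ 2 $ 2 * of_int n) / \<rho> $ 2 $ 1)"

definition is_representative_system ::
  "int \<Rightarrow> real ^ 2 ^ 2 \<Rightarrow> real ^ 2 ^ 2 \<Rightarrow> real \<Rightarrow> ((real ^ 2 ^ 2) set \<Rightarrow> real ^ 2 ^ 2) \<Rightarrow> bool" where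
  "is_representative_system N \<sigma>a \<sigma>b \<gamma> rep \<longleftrightarrow>
     (\<forall>D \<in> double_cosets_of_modulus N \<sigma>a \<sigma>b \<gamma>. rep D \<in> D \<and> rep D $ 2 $ 1 = \<gamma>)"

text \<open>
  The Kloosterman sum for a given choice \<open>rep\<close> of representatives; its value does not depend on
  that choice when both cusps are singular for the character.
\<close>

definition kloosterman_sum ::
  "int \<Rightarrow> real ^ 2 ^ 2 \<Rightarrow> real ^ 2 ^ 2 \<Rightarrow> ((real ^ 2 ^ 2) set \<Rightarrow> real ^ 2 ^ 2) \<Rightarrow>
   int \<Rightarrow> int \<Rightarrow> real \<Rightarrow> (int \<Rightarrow> complex) \<Rightarrow> complex" where
  "kloosterman_sum N \<sigma>a \<sigma>b rep m n \<gamma> chi =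
     (\<Sum>D \<in> double_cosets_of_modulus N \<sigma>a \<sigma>b \<gamma>. kloosterman_term \<sigma>a \<sigma>b chi m n (rep D))"

definition f_factor ::
  "int \<Rightarrow> int \<Rightarrow> int \<Rightarrow> int \<Rightarrow> (int \<Rightarrow> complex) \<Rightarrow> (int \<Rightarrow> complex) \<Rightarrow>
   (int \<Rightarrow> complex) \<Rightarrow> (int \<Rightarrow> complex) \<Rightarrow> complex" where
  "f_factor p q u v chi_p chi_q chi_u chi_v =
     chi_v (- 1) * cnj (chi_p u * chi_v u) * (chi_q v * chi_u v) * chi_u (p * q) * cnj (chi_v (p * q))"

end

theory Submission
  imports Defs "HOL-Number_Theory.Residues"
begin

text \<open>
  Write \<open>w = sqrt (u v)\<close>. Conjugation by the two scaling matrices turns \<open>\<Gamma>\<^sub>0(N)\<close> into the set of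
  determinant one matrices with rows \<open>(a w, b / w)\<close> and \<open>(c w, d w)\<close>, where \<open>a\<close>, \<open>b\<close>, \<open>c\<close>, \<open>d\<close> are
  integers and \<open>p q\<close> divides \<open>c\<close>. The determinant condition \<open>u v a d - b c = 1\<close> gives the allowed
  moduli. Translations on the left and right shift \<open>a\<close> and \<open>d\<close> by multiples of \<open>c\<close>, so the double
  cosets of modulus \<open>c w\<close> are parametrised by residues with \<open>u v a d \<equiv> 1\<close> modulo \<open>c\<close>; replacing
  \<open>a\<close> by its product with \<open>u v\<close> gives the index set of the classical sum. The lower right entry \<open>D\<close>
  of the corresponding matrix in \<open>\<Gamma>\<^sub>0(N)\<close> satisfies \<open>D \<equiv> u d\<close> modulo \<open>p\<close>, \<open>D \<equiv> u a\<close> modulo \<open>q\<close>,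
  \<open>p q v D \<equiv> c\<close> modulo \<open>u\<close> and \<open>c D \<equiv> - p q u\<close> modulo \<open>v\<close>, which yields the four character factors.
\<close>

section \<open>Real two-by-two matrices, \<open>Gamma_inf\<close> and its double cosets\<close>

lemma mat2_nth [simp]:
  "mat2 a b c d $ 1 $ 1 = a" "mat2 a b c d $ 1 $ 2 = b"
  "mat2 a b c d $ 2 $ 1 = c" "mat2 a b c d $ 2 $ 2 = d"
  by (simp_all add: mat2_def)

lemma mat2_eq_iff: "mat2 a b c d = mat2 a' b' c' d' \<longleftrightarrow> a = a' \<and> b = b' \<and> c = c' \<and> d = d'"
  by (auto simp: vec_eq_iff forall_2)

lemma mat2_mult:
  "mat2 a b c d ** mat2 a' b' c' d' =
     mat2 (a * a' + b * c') (a * b' + b * d') (c * a' + d * c') (c * b' + d * d')"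
  by (simp add: vec_eq_iff forall_2 matrix_matrix_mult_def sum_2)

lemma mat2_uminus: "- mat2 a b c d = mat2 (- a) (- b) (- c) (- d)"
  by (simp add: vec_eq_iff forall_2)

lemma mat2_one: "mat2 1 0 0 1 = mat 1"
  by (simp add: vec_eq_iff forall_2 mat_def)

lemma matrix_inv_mat2:
  assumes "a * d - b * c = 1"
  shows "matrix_inv (mat2 a b c d) = mat2 d (- b) (- c) a"
proof -
  let ?A = "mat2 a b c d" and ?B = "mat2 d (- b) (- c) a"
  have AB: "?A ** ?B = mat 1" "?B ** ?A = mat 1"
    using assms by (auto simp: mat2_mult mat2_one [symmetric] mat2_eq_iff algebra_simps)
  \<comment> \<open>\<open>matrix_inv\<close> chooses some two-sided inverse; \<open>?B\<close>
    witnesses that one exists, and associativity then identifies the chosen one with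
    \<open>?B\<close>.\<close>
  then have "?A ** matrix_inv ?A = mat 1"
    unfolding matrix_inv_def by - (rule someI2 [of _ ?B], auto)
  then have "?B ** (?A ** matrix_inv ?A) = ?B ** mat 1"
    by simp
  then show ?thesis
    by (simp only: matrix_mul_assoc AB matrix_mul_lid matrix_mul_rid)
qed

text \<open>Carrying the sign as a factor \<open>\<epsilon>\<close> lets both kinds of elements
  enter matrix products at once.\<close>

lemma Gamma_infE:
  assumes "A \<in> Gamma_inf"
  obtains \<epsilon> n :: int where "\<epsilon> = 1 \<or> \<epsilon> = - 1" "A = mat2 \<epsilon> (\<epsilon> * n) 0 \<epsilon>"
proof -
  from assms obtain n :: int where "A = mat2 1 n 0 1 \<or> A = - mat2 1 n 0 1"
    by (auto simp: Gamma_inf_def)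
  then show thesis
    using that [of 1 n] that [of "- 1" n] by (auto simp: mat2_uminus)
qed

lemma Gamma_infI: "mat2 1 (of_int n) 0 1 \<in> Gamma_inf"
  by (auto simp: Gamma_inf_def)

lemma Gamma_inf_mult:
  assumes "A \<in> Gamma_inf" "B \<in> Gamma_inf"
  shows "A ** B \<in> Gamma_inf"
proof -
  from assms obtain m n :: int where
    "A = mat2 1 m 0 1 \<or> A = - mat2 1 m 0 1" "B = mat2 1 n 0 1 \<or> B = - mat2 1 n 0 1"
    by (auto simp: Gamma_inf_def)
  then have "A ** B = mat2 1 (of_int (m + n)) 0 1 \<or> A ** B = - mat2 1 (of_int (m + n)) 0 1"
    by (auto simp: mat2_uminus mat2_mult mat2_eq_iff)
  then show ?thesis
    unfolding Gamma_inf_def by blast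
qed

lemma self_in_Gamma_inf_double_coset: "\<rho> \<in> Gamma_inf_double_coset \<rho>"
proof -
  have "\<rho> = mat2 1 (of_int 0) 0 1 ** \<rho> ** mat2 1 (of_int 0) 0 1"
    by (simp add: mat2_one)
  then show ?thesis
    unfolding Gamma_inf_double_coset_def using Gamma_infI by blast
qed

text \<open>\<open>Gamma_inf\<close> absorbs the translations, which gives one inclusion for
  arbitrary shifts. The other follows from the same inclusion with the shifts \<open>- i\<close> and
  \<open>- j\<close>, which undo the first ones.\<close>

lemma Gamma_inf_double_coset_translate:
  fixes i j :: int
  shows "Gamma_inf_double_coset (mat2 1 i 0 1 ** \<rho> ** mat2 1 j 0 1) = Gamma_inf_double_coset \<rho>"
proof -
  have sub: "Gamma_inf_double_coset (mat2 1 k 0 1 ** \<eta> ** mat2 1 l 0 1)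
      \<subseteq> Gamma_inf_double_coset \<eta>" for k l :: int and \<eta>
  proof
    fix M assume "M \<in> Gamma_inf_double_coset (mat2 1 k 0 1 ** \<eta> ** mat2 1 l 0 1)"
    then obtain A B where AB: "A \<in> Gamma_inf" "B \<in> Gamma_inf"
      and M: "M = A ** (mat2 1 k 0 1 ** \<eta> ** mat2 1 l 0 1) ** B"
      by (auto simp: Gamma_inf_double_coset_def)
    have "M = (A ** mat2 1 k 0 1) ** \<eta> ** (mat2 1 l 0 1 ** B)"
      by (simp add: M matrix_mul_assoc)
    then show "M \<in> Gamma_inf_double_coset \<eta>"
      unfolding Gamma_inf_double_coset_def using AB Gamma_inf_mult Gamma_infI by blast
  qed
  have cancel: "mat2 1 (- real_of_int k) 0 1 ** mat2 1 k 0 1 = mat 1"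
    "mat2 1 k 0 1 ** mat2 1 (- real_of_int k) 0 1 = mat 1" for k
    by (simp_all add: mat2_mult mat2_one)
  have "mat2 1 (of_int (- i)) 0 1 ** (mat2 1 i 0 1 ** \<rho> ** mat2 1 j 0 1)
      ** mat2 1 (of_int (- j)) 0 1 = (mat2 1 (- real_of_int i) 0 1 ** mat2 1 i 0 1) ** \<rho>
      ** (mat2 1 j 0 1 ** mat2 1 (- real_of_int j) 0 1)"
    by (simp add: matrix_mul_assoc)
  also have "\<dots> = \<rho>"
    by (simp add: cancel)
  finally show ?thesis
    using sub [of i \<rho> j] sub [of "- i" "mat2 1 i 0 1 ** \<rho> ** mat2 1 j 0 1" "- j"] by auto
qed

section \<open>Values of Dirichlet characters and of the exponential \<open>e\<close>\<close>

lemma dirichlet_character_mult: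
  "dirichlet_character n chi \<Longrightarrow> chi (a * b) = chi a * chi b"
  by (simp add: dirichlet_character_def)

lemma dirichlet_character_cong:
  assumes chi: "dirichlet_character n chi" and ab: "[a = b] (mod n)"
  shows "chi a = chi b"
proof -
  have step: "chi (x + n) = chi x" for x
    using chi by (simp add: dirichlet_character_def)
  have shift: "chi (x + int k * n) = chi x" for x k
  proof (induction k)
    case (Suc k)
    then show ?case
      using step [of "x + int k * n"] by (simp add: algebra_simps)
  qed simp
  obtain k where k: "b = a + n * k"
    using ab by (auto simp: cong_iff_lin)
  show ?thesis
  \<comment> \<open>The induction covers only shifts by natural multiples of \<open>n\<close>; for
    negative \<open>k\<close> the shift starts from \<open>b\<close> instead.\<close>
  proof (cases "k \<ge> 0")
    case True
    then show ?thesis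
      using shift [of a "nat k"] k by (simp add: mult.commute)
  next
    case False
    then show ?thesis
      using shift [of b "nat (- k)"] k by (simp add: mult.commute)
  qed
qed

text \<open>By Euler's theorem some positive power of \<open>a\<close> is 1 modulo \<open>n\<close>,
  so \<open>chi a\<close> is a root of unity.\<close>

lemma norm_dirichlet_character:
  assumes chi: "dirichlet_character n chi" and n: "n > 0" and a: "coprime a n"
  shows "norm (chi a) = 1"
proof -
  have "chi 1 \<noteq> 0"
    using chi by (auto simp: dirichlet_character_def)
  with dirichlet_character_mult [OF chi, of 1 1] have one: "chi 1 = 1"
    by simp
  have pow: "chi (a ^ k) = chi a ^ k" for k
    by (induction k) (simp_all add: one dirichlet_character_mult [OF chi])
  have "\<exists>k>0. [a ^ k = 1] (mod n)"
  \<comment> \<open>The locale \<open>residues\<close> requires a modulus above 1.\<close>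
  proof (cases "n = 1")
    case True
    then show ?thesis by auto
  next
    case False
    with n have "residues n"
      by (simp add: residues_def)
    then show ?thesis
      using residues.euler_theorem a n by (intro exI [of _ "totient (nat n)"]) auto
  qed
  then obtain k where "k > 0" and "[a ^ k = 1] (mod n)"
    by blast
  then have "norm (chi a) ^ k = 1 ^ k"
    using dirichlet_character_cong [OF chi, of "a ^ k" 1] by (simp add: pow one flip: norm_power)
  with \<open>k > 0\<close> show ?thesis
    by (metis power_eq_imp_eq_base norm_ge_zero zero_le_one)
qed

text \<open>At the unit \<open>y\<close> the conjugate value is the inverse value. This evaluates
  the conjugate at \<open>x\<close> when only a multiple of \<open>x\<close> is known modulo
  \<open>n\<close>; if \<open>x\<close> is not a unit, both sides vanish.\<close>

lemma cnj_dirichlet_character_eq: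
  assumes chi: "dirichlet_character n chi" and n: "n > 0" and y: "coprime y n"
    and xy: "[x * y = z] (mod n)"
  shows "cnj (chi x) = chi y * cnj (chi z)"
proof -
  have "chi y * cnj (chi y) = 1"
    using norm_dirichlet_character [OF chi n y] by (simp add: complex_norm_square [symmetric])
  moreover have "cnj (chi z) = cnj (chi x) * cnj (chi y)"
    using dirichlet_character_cong [OF chi xy] dirichlet_character_mult [OF chi]
    by (metis complex_cnj_mult)
  ultimately show ?thesis
    by (simp add: mult.left_commute)
qed

lemma cnj_dirichlet_character_minus_one:
  assumes chi: "dirichlet_character n chi" and n: "n > 0"
  shows "cnj (chi (- 1)) = chi (- 1)"
proof -
  have "cnj (chi (- 1)) = chi (- 1) * cnj (chi 1)"
    by (rule cnj_dirichlet_character_eq [OF chi n]) auto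
  \<comment> \<open>Cancelling the nonzero conjugate gives \<open>chi 1 = 1\<close>.\<close>
  moreover have "cnj (chi 1) = chi 1 * cnj (chi 1)" "chi 1 \<noteq> 0"
    using cnj_dirichlet_character_eq [OF chi n, of 1 1 1] chi
    by (auto simp: dirichlet_character_def)
  ultimately show ?thesis by simp
qed

lemma e_eq_if_diff_Ints:
  assumes "x - y \<in> \<int>"
  shows "e x = e y"
proof -
  from assms obtain k :: int where "x = y + k"
    by (auto elim!: Ints_cases simp: algebra_simps)
  then show ?thesis
    by (simp add: e_def distrib_left exp_add exp_eq_1 mult_ac)
qed

section \<open>Scaling matrices, and matrices twisted by a square root\<close>

lemma scaling_mat_eq:
  fixes r s sbar k :: int
  assumes "r > 0" "s > 0" "sbar * s - 1 = r * k"
  shows "scaling_mat r s sbar =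
    mat2 (sqrt s) (k / sqrt s) (r * sqrt s) (sbar * sqrt s)"
proof -
  have "real_of_int (sbar * s - 1) / real_of_int r = k"
    unfolding assms(3) using assms(1) by simp
  moreover have "real_of_int sbar * s / sqrt s = sbar * sqrt s"
    using assms(2) by (simp add: real_div_sqrt flip: times_divide_eq_right)
  ultimately show ?thesis
    by (simp add: scaling_mat_def tau_mat_def nu_mat_def mat2_mult mat2_eq_iff)
qed

text \<open>The determinant is \<open>t * a * d - b * c\<close>. If it is 1,
  \<open>t = u * v\<close> and \<open>p * q\<close> divides \<open>c\<close>, this is a normalised
  Atkin-Lehner matrix of level \<open>p * q * u * v\<close> for the divisor
  \<open>u * v\<close>.\<close>

definition twisted_mat :: "int \<Rightarrow> int \<Rightarrow> int \<Rightarrow> int \<Rightarrow> int \<Rightarrow> real ^ 2 ^ 2" where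
  "twisted_mat t a b c d = mat2 (a * sqrt t) (b / sqrt t) (c * sqrt t) (d * sqrt t)"

lemma twisted_mat_translate:
  fixes i j :: int
  assumes "t > 0"
  shows "mat2 1 i 0 1 ** twisted_mat t a b c d ** mat2 1 j 0 1 =
    twisted_mat t (a + i * c) (b + t * (j * a + i * d + i * j * c)) c (d + j * c)"
proof -
  have "x * sqrt t = x * t / sqrt t" for x :: real
    using assms by (simp add: real_div_sqrt flip: times_divide_eq_right)
  then show ?thesis
    using assms by (simp add: twisted_mat_def mat2_mult mat2_eq_iff algebra_simps add_divide_distrib)
qed

text \<open>The two outer factors multiply the lower left entry by the product of their signs. As
  that entry stays equal to a positive number, the signs agree and cancel, and only translations
  remain.\<close>

lemma Gamma_inf_double_coset_twisted_matE:
  assumes M: "M \<in> Gamma_inf_double_coset (twisted_mat t a b c d)" "M $ 2 $ 1 = c * sqrt t"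
    and pos: "t > 0" "c > 0" and det: "t * a * d - b * c = 1"
  obtains i j b' where "M = twisted_mat t (a + i * c) b' c (d + j * c)"
    "t * (a + i * c) * (d + j * c) - b' * c = 1"
proof -
  from M(1) obtain A B where A: "A \<in> Gamma_inf" and B: "B \<in> Gamma_inf"
    and M_eq: "M = A ** twisted_mat t a b c d ** B"
    by (auto simp: Gamma_inf_double_coset_def)
  obtain \<epsilon> i where \<epsilon>: "\<epsilon> = 1 \<or> \<epsilon> = - 1"
    and A: "A = mat2 (real_of_int \<epsilon>) (real_of_int (\<epsilon> * i)) 0 (real_of_int \<epsilon>)"
    using A by (rule Gamma_infE)
  obtain \<delta> j where \<delta>: "\<delta> = 1 \<or> \<delta> = - 1"
    and B: "B = mat2 (real_of_int \<delta>) (real_of_int (\<delta> * j)) 0 (real_of_int \<delta>)"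
    using B by (rule Gamma_infE)
  have "real_of_int (\<epsilon> * \<delta>) * (c * sqrt t) = c * sqrt t"
    using M(2) unfolding M_eq A B by (simp add: twisted_mat_def mat2_mult mult_ac)
  then have "real_of_int (\<epsilon> * \<delta>) = 1"
    using pos by simp
  with \<epsilon> \<delta> have \<epsilon>\<delta>: "\<epsilon> = 1 \<and> \<delta> = 1 \<or> \<epsilon> = - 1 \<and> \<delta> = - 1"
    by auto
  then have "M = mat2 1 i 0 1 ** twisted_mat t a b c d ** mat2 1 j 0 1"
    unfolding M_eq A B by (auto simp: twisted_mat_def mat2_mult mat2_eq_iff algebra_simps)
  then show thesis
    using that det by (simp add: twisted_mat_translate [OF pos(1)] algebra_simps)
qed

text \<open>Translations match the diagonal entries; since \<open>c\<close> is nonzero, the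
  determinant condition then determines the upper right entry.\<close>

lemma Gamma_inf_double_coset_twisted_mat_eq:
  assumes t: "t > 0" and c: "c \<noteq> 0"
    and det: "t * a * d - b * c = 1" "t * a' * d' - b' * c = 1"
    and cong: "[a = a'] (mod c)" "[d = d'] (mod c)"
  shows "Gamma_inf_double_coset (twisted_mat t a b c d) =
    Gamma_inf_double_coset (twisted_mat t a' b' c d')"
proof -
  obtain i j where ij: "a' = a + i * c" "d' = d + j * c"
    using cong by (auto simp: cong_iff_lin mult.commute)
  have "b' * c = (b + t * (j * a + i * d + i * j * c)) * c"
    using det unfolding ij by (simp add: algebra_simps)
  then have "b' = b + t * (j * a + i * d + i * j * c)"
    using c by simp
  then show ?thesis
    using Gamma_inf_double_coset_translate [of i "twisted_mat t a b c d" j]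
    by (simp add: twisted_mat_translate [OF t] ij)
qed

section \<open>The pair of cusps: conjugated group and allowed moduli\<close>

locale atkin_lehner_pair =
  fixes p q u v s1bar s2bar k1 k2 :: int
  assumes pos: "p > 0" "q > 0" "u > 0" "v > 0"
    and bezout1: "s1bar * (q * v) - 1 = p * u * k1"
    and bezout2: "s2bar * (q * u) - 1 = p * v * k2"
begin

abbreviation "\<sigma>1 \<equiv> scaling_mat (p * u) (q * v) s1bar"
abbreviation "\<sigma>2 \<equiv> scaling_mat (p * v) (q * u) s2bar"

text \<open>The two Bezout identities make \<open>q * v\<close> coprime to \<open>p * u\<close> and
  \<open>q * u\<close> coprime to \<open>p * v\<close>, which together covers all six pairs.\<close>

lemma coprime_factors:
  "coprime p q" "coprime p u" "coprime p v" "coprime q u" "coprime q v" "coprime u v"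
proof -
  have *: "coprime x y" if "z * x - 1 = y * w" for x y z w :: int
  proof -
    have "z * x + (- w) * y = 1"
      using that by (simp add: mult.commute)
    then show ?thesis
      by (metis coprimeI dvd_add dvd_mult)
  qed
  have "coprime (q * v) (p * u)" "coprime (q * u) (p * v)"
    using * [OF bezout1] * [OF bezout2] by simp_all
  then show "coprime p q" "coprime p u" "coprime p v" "coprime q u" "coprime q v" "coprime u v"
    by (simp_all add: coprime_commute)
qed

text \<open>
  The entries of the matrix in \<open>\<Gamma>\<^sub>0(N)\<close> corresponding to
  \<open>twisted_mat (u * v) a b (p * q * c) d\<close>; the lower left one is \<open>N * lift_c a b c d\<close>.
\<close>

definition lift_a :: "int \<Rightarrow> int \<Rightarrow> int \<Rightarrow> int \<Rightarrow> int" where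
  "lift_a a b c d =
     s2bar * (q * u * v * a + k1 * u * (p * q * c)) - p * v * (q * b + k1 * u * d)"

definition lift_b :: "int \<Rightarrow> int \<Rightarrow> int \<Rightarrow> int \<Rightarrow> int" where
  "lift_b a b c d = - k2 * (v * a + k1 * p * c) + q * b + k1 * u * d"

definition lift_c :: "int \<Rightarrow> int \<Rightarrow> int \<Rightarrow> int \<Rightarrow> int" where
  "lift_c a b c d = (u * a + s1bar * q * c) * s2bar - p * b - s1bar * v * d"

definition lift_d :: "int \<Rightarrow> int \<Rightarrow> int \<Rightarrow> int \<Rightarrow> int" where
  "lift_d a b c d =
     - v * (p * u * a + s1bar * (p * q * c)) * k2 + q * (p * u * b + s1bar * u * v * d)"

lemma lift_det:
  assumes "u * v * a * d - b * (p * q * c) = 1"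
  shows "lift_a a b c d * lift_d a b c d - lift_b a b c d * (p * q * u * v * lift_c a b c d) = 1"
proof -
  \<comment> \<open>Multiplicativity of the determinant as a polynomial identity: the outer factors
    are the determinants of \<open>\<sigma>1\<close> and \<open>\<sigma>2\<close>.\<close>
  have "lift_a a b c d * lift_d a b c d - lift_b a b c d * (p * q * u * v * lift_c a b c d) =
      (s1bar * (q * v) - p * u * k1) * (u * v * a * d - b * (p * q * c)) *
      (s2bar * (q * u) - p * v * k2)"
    unfolding lift_a_def lift_b_def lift_c_def lift_d_def by (simp add: algebra_simps)
  also have "\<dots> = 1"
    using assms bezout1 bezout2 by (simp add: algebra_simps)
  finally show ?thesis .
qed

text \<open>Writing \<open>q\<close>, \<open>u\<close>, \<open>v\<close> as squares turns
  comparisons of matrix entries into identities of rational functions in \<open>Q\<close>,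
  \<open>U\<close>, \<open>V\<close>.\<close>

lemma sqrt_factors:
  obtains Q U V :: real where "Q \<noteq> 0" "U \<noteq> 0" "V \<noteq> 0"
    "real_of_int q = Q * Q" "real_of_int u = U * U" "real_of_int v = V * V"
    "sqrt (q * v) = Q * V" "sqrt (q * u) = Q * U" "sqrt (u * v) = U * V"
  using that [of "sqrt (real_of_int q)" "sqrt (real_of_int u)" "sqrt (real_of_int v)"] pos
  by (auto simp: real_sqrt_mult)

lemma sigma_eq:
  "\<sigma>1 = mat2 (sqrt (q * v)) (k1 / sqrt (q * v)) (p * u * sqrt (q * v)) (s1bar * sqrt (q * v))"
  "\<sigma>2 = mat2 (sqrt (q * u)) (k2 / sqrt (q * u)) (p * v * sqrt (q * u)) (s2bar * sqrt (q * u))"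
  using scaling_mat_eq [OF _ _ bezout1] scaling_mat_eq [OF _ _ bezout2] pos by simp_all

lemma sigma_det:
  "sqrt (q * v) * (s1bar * sqrt (q * v)) - k1 / sqrt (q * v) * (p * u * sqrt (q * v)) = 1"
  "sqrt (q * u) * (s2bar * sqrt (q * u)) - k2 / sqrt (q * u) * (p * v * sqrt (q * u)) = 1"
proof -
  have *: "s1bar * (q * v) - (p * u * k1) = 1" "s2bar * (q * u) - (p * v * k2) = 1"
    using bezout1 bezout2 by auto
  show
    "sqrt (q * v) * (s1bar * sqrt (q * v)) - k1 / sqrt (q * v) * (p * u * sqrt (q * v)) = 1"
    "sqrt (q * u) * (s2bar * sqrt (q * u)) - k2 / sqrt (q * u) * (p * v * sqrt (q * u)) = 1"
    using pos arg_cong [OF *(1), of real_of_int] arg_cong [OF *(2), of real_of_int]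
    by (auto simp: field_simps)
qed

lemmas sigma_inv =
  matrix_inv_mat2 [OF sigma_det(1), folded sigma_eq] matrix_inv_mat2 [OF sigma_det(2), folded sigma_eq]

lemma sigma_inv_cancel:
  "\<sigma>1 ** matrix_inv \<sigma>1 = mat 1" "matrix_inv \<sigma>1 ** \<sigma>1 = mat 1"
  "\<sigma>2 ** matrix_inv \<sigma>2 = mat 1" "matrix_inv \<sigma>2 ** \<sigma>2 = mat 1"
  unfolding sigma_inv unfolding sigma_eq
  using sigma_det by (auto simp: mat2_mult mat2_eq_iff algebra_simps simp flip: mat2_one)

lemma twisted_to_Gamma0:
  "\<sigma>1 ** twisted_mat (u * v) a b (p * q * c) d ** matrix_inv \<sigma>2 =
     mat2 (lift_a a b c d) (lift_b a b c d) (p * q * u * v * lift_c a b c d) (lift_d a b c d)"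
proof (rule sqrt_factors)
  fix Q U V :: real
  assume "Q \<noteq> 0" "U \<noteq> 0" "V \<noteq> 0"
    "real_of_int q = Q * Q" "real_of_int u = U * U" "real_of_int v = V * V"
    "sqrt (q * v) = Q * V" "sqrt (q * u) = Q * U" "sqrt (u * v) = U * V"
  then show ?thesis
    unfolding twisted_mat_def sigma_inv unfolding sigma_eq mat2_mult mat2_eq_iff
      lift_a_def lift_b_def lift_c_def lift_d_def
    by (simp add: divide_simps) (simp add: algebra_simps)
qed

text \<open>In the lower left entry, \<open>sqrt (q * v) * sqrt (q * u) = q * sqrt (u * v)\<close>
  supplies the factor \<open>q\<close>. The factor \<open>p\<close> is common to
  \<open>p * u\<close>, \<open>p * v\<close> and the level.\<close>

lemma Gamma0_to_twisted:
  "matrix_inv \<sigma>1 ** mat2 (of_int A) (of_int B) (of_int (p * q * u * v * C)) (of_int D) ** \<sigma>2 =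
     twisted_mat (u * v) (s1bar * q * (A + p * v * B) - k1 * (p * q * u * C + p * D))
       (s1bar * v * A * k2 + s1bar * B * s2bar * q * u * v - k1 * p * u * v * C * k2 -
        k1 * D * s2bar * u)
       (p * q * (- u * (A + p * v * B) + q * u * v * C + v * D))
       (- p * A * k2 - p * u * B * s2bar * q + p * q * v * C * k2 + D * s2bar * q)"
proof (rule sqrt_factors)
  fix Q U V :: real
  assume "Q \<noteq> 0" "U \<noteq> 0" "V \<noteq> 0"
    "real_of_int q = Q * Q" "real_of_int u = U * U" "real_of_int v = V * V"
    "sqrt (q * v) = Q * V" "sqrt (q * u) = Q * U" "sqrt (u * v) = U * V"
  then show ?thesis
    unfolding twisted_mat_def sigma_inv unfolding sigma_eq mat2_mult mat2_eq_iff
    by (simp add: divide_simps) (simp add: algebra_simps)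
qed

lemma conj_Gamma0_eq:
  "conj_Gamma0 (p * q * u * v) \<sigma>1 \<sigma>2 =
     {twisted_mat (u * v) a b (p * q * c) d | a b c d. u * v * a * d - b * (p * q * c) = 1}"
    (is "_ = ?T")
proof (intro subset_antisym subsetI)
  fix M assume "M \<in> conj_Gamma0 (p * q * u * v) \<sigma>1 \<sigma>2"
  then obtain A B C D :: int where det: "A * D - B * (p * q * u * v * C) = 1"
    and M: "M = matrix_inv \<sigma>1 ** mat2 A B (of_int (p * q * u * v * C)) D ** \<sigma>2"
    by (auto simp: conj_Gamma0_def Gamma0_def)
  let ?a = "s1bar * q * (A + p * v * B) - k1 * (p * q * u * C + p * D)"
  let ?b = "s1bar * v * A * k2 + s1bar * B * s2bar * q * u * v - k1 * p * u * v * C * k2 -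
        k1 * D * s2bar * u"
  let ?c = "- u * (A + p * v * B) + q * u * v * C + v * D"
  let ?d = "- p * A * k2 - p * u * B * s2bar * q + p * q * v * C * k2 + D * s2bar * q"
  have "u * v * ?a * ?d - ?b * (p * q * ?c) =
      (s1bar * (q * v) - p * u * k1) * (A * D - B * (p * q * u * v * C)) *
      (s2bar * (q * u) - p * v * k2)"
    by (simp add: algebra_simps)
  also have "\<dots> = 1"
    using det bezout1 bezout2 by (simp add: algebra_simps)
  finally show "M \<in> ?T"
    unfolding M Gamma0_to_twisted by blast
next
  fix M assume "M \<in> ?T"
  then obtain a b c d where det: "u * v * a * d - b * (p * q * c) = 1"
    and M: "M = twisted_mat (u * v) a b (p * q * c) d"
    by blast
  let ?g = "\<sigma>1 ** M ** matrix_inv \<sigma>2"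
  have "?g \<in> Gamma0 (p * q * u * v)"
    unfolding M twisted_to_Gamma0 Gamma0_def using lift_det [OF det] by blast
  moreover have "matrix_inv \<sigma>1 ** ?g ** \<sigma>2 = (matrix_inv \<sigma>1 ** \<sigma>1) ** M ** (matrix_inv \<sigma>2 ** \<sigma>2)"
    by (simp add: matrix_mul_assoc)
  then have "M = matrix_inv \<sigma>1 ** ?g ** \<sigma>2"
    by (simp add: sigma_inv_cancel)
  ultimately show "M \<in> conj_Gamma0 (p * q * u * v) \<sigma>1 \<sigma>2"
    unfolding conj_Gamma0_def by blast
qed

lemma allowed_moduli_eq:
  "allowed_moduli (p * q * u * v) \<sigma>1 \<sigma>2 =
     {\<gamma>. \<exists>c::int. \<gamma> = of_int c * sqrt (of_int (u * v)) \<and> \<gamma> > 0 \<and>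
            [c = 0] (mod (p * q)) \<and> coprime c (u * v)}" (is "_ = ?R")
proof (intro subset_antisym subsetI)
  fix \<gamma> assume "\<gamma> \<in> allowed_moduli (p * q * u * v) \<sigma>1 \<sigma>2"
  then obtain a b c d where det: "u * v * a * d - b * (p * q * c) = 1" and "\<gamma> > 0"
    and \<gamma>: "\<gamma> = twisted_mat (u * v) a b (p * q * c) d $ 2 $ 1"
    by (auto simp: allowed_moduli_def conj_Gamma0_eq)
  have "coprime (p * q * c) (u * v)"
  proof (rule coprimeI)
    fix k assume "k dvd p * q * c" "k dvd u * v"
    then have "k dvd (u * v) * (a * d) - b * (p * q * c)"
      by (metis dvd_diff dvd_mult dvd_mult2)
    with det show "is_unit k"
      by (simp add: mult.assoc)
  qed
  with \<gamma> \<open>\<gamma> > 0\<close> show "\<gamma> \<in> ?R"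
    by (auto simp: twisted_mat_def cong_0_iff intro!: exI [of _ "p * q * c"])
next
  fix \<gamma> assume "\<gamma> \<in> ?R"
  then obtain c1 where \<gamma>: "\<gamma> = of_int (p * q * c1) * sqrt (u * v)" "\<gamma> > 0"
    and "coprime (p * q * c1) (u * v)"
    by (clarsimp simp: cong_0_iff dvd_def) blast
  then obtain x y where "(p * q * c1) * x + (u * v) * y = 1"
    by (metis bezout_int coprime_imp_gcd_eq_1 mult.commute)
  \<comment> \<open>With lower right entry 1, the Bezout coefficients serve as the upper
    row.\<close>
  then have "u * v * y * 1 - (- x) * (p * q * c1) = 1"
    by (simp add: algebra_simps)
  then have "twisted_mat (u * v) y (- x) (p * q * c1) 1 \<in> conj_Gamma0 (p * q * u * v) \<sigma>1 \<sigma>2"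
    unfolding conj_Gamma0_eq by blast
  moreover have "twisted_mat (u * v) y (- x) (p * q * c1) 1 $ 2 $ 1 = \<gamma>"
    using \<gamma> by (simp add: twisted_mat_def)
  ultimately show "\<gamma> \<in> allowed_moduli (p * q * u * v) \<sigma>1 \<sigma>2"
    unfolding allowed_moduli_def using \<gamma> by blast
qed

text \<open>The multipliers on the left avoid inverses and are units for their moduli. The first
  Bezout identity gives \<open>s1bar * q * v\<close> congruent to 1 modulo \<open>p\<close> and
  \<open>u\<close>, the second gives \<open>p * v * k2\<close> congruent to -1 modulo
  \<open>q\<close> and \<open>u\<close>.\<close>

lemma lift_d_cong:
  assumes "u * v * a * d - b * (p * q * c) = 1"
  shows "[lift_d a b c d = u * d] (mod p)"
    "[lift_d a b c d * v = u * v * a] (mod q)"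
    "[lift_d a b c d * (v * (p * q)) = p * q * c] (mod u)"
    "[lift_d a b c d * (p * q * c) = - 1 * (u * (p * q))] (mod v)"
proof -
  let ?D = "lift_d a b c d"
  have "?D - u * d = p * (- v * u * a * k2 - v * s1bar * q * c * k2 + q * u * b) +
      (s1bar * (q * v) - 1) * (u * d)"
    unfolding lift_d_def by (simp add: algebra_simps)
  also have "\<dots> = p * (- v * u * a * k2 - v * s1bar * q * c * k2 + q * u * b + u * u * k1 * d)"
    unfolding bezout1 by (simp add: algebra_simps)
  finally have "?D - u * d = \<dots>" .
  then show "[?D = u * d] (mod p)"
    unfolding cong_iff_dvd_diff by (rule dvdI)
  have "?D * v - u * v * a = q * (- v * v * s1bar * p * c * k2 + v * (p * u * b + s1bar * u * v * d)) -
      (p * v * k2 + 1) * (u * v * a)"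
    unfolding lift_d_def by (simp add: algebra_simps)
  also have "\<dots> = q * (- u * v * a * u * s2bar - v * v * s1bar * p * c * k2 +
      v * (p * u * b + s1bar * u * v * d))"
    unfolding bezout2 [symmetric] by (simp add: algebra_simps)
  finally have "?D * v - u * v * a = \<dots>" .
  then show "[?D * v = u * v * a] (mod q)"
    unfolding cong_iff_dvd_diff by (rule dvdI)
  have "?D * (v * (p * q)) - p * q * c =
      - (p * v * k2) * v * q * (p * u * a + s1bar * (p * q * c)) +
      u * (q * v * p * q * (p * b + s1bar * v * d)) - p * q * c"
    unfolding lift_d_def by (simp add: algebra_simps)
  also have "\<dots> = u * (- q * s2bar * v * q * (p * u * a + s1bar * (p * q * c)) + v * q * p * a +
      q * v * p * q * (p * b + s1bar * v * d)) + (s1bar * (q * v) - 1) * (p * q * c)"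
    unfolding bezout2 [symmetric] by (simp add: algebra_simps)
  also have "\<dots> = u * (- q * s2bar * v * q * (p * u * a + s1bar * (p * q * c)) + v * q * p * a +
      p * k1 * (p * q * c) + q * v * p * q * (p * b + s1bar * v * d))"
    unfolding bezout1 by (simp add: algebra_simps)
  finally have "?D * (v * (p * q)) - p * q * c = \<dots>" .
  then show "[?D * (v * (p * q)) = p * q * c] (mod u)"
    unfolding cong_iff_dvd_diff by (rule dvdI)
  \<comment> \<open>Modulo \<open>v\<close> only the term \<open>q * p * u * b\<close> survives;
    multiplied by \<open>p * q * c\<close> it contains this product, which is -1 modulo
    \<open>v\<close>.\<close>
  have bc: "b * (p * q * c) = u * v * a * d - 1"
    using assms by simp
  have "?D * (p * q * c) - (- 1 * (u * (p * q))) =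
      v * (- (p * u * a + s1bar * (p * q * c)) * k2 * (p * q * c) +
        q * s1bar * u * d * (p * q * c)) + q * p * u * (b * (p * q * c)) + u * (p * q)"
    unfolding lift_d_def by (simp add: algebra_simps)
  also have "\<dots> = v * (- (p * u * a + s1bar * (p * q * c)) * k2 * (p * q * c) +
        q * s1bar * u * d * (p * q * c) + q * p * u * u * a * d)"
    unfolding bc by (simp add: algebra_simps)
  finally have "?D * (p * q * c) - (- 1 * (u * (p * q))) = \<dots>" .
  then show "[?D * (p * q * c) = - 1 * (u * (p * q))] (mod v)"
    unfolding cong_iff_dvd_diff by (rule dvdI)
qed


section \<open>Parametrisation of the double cosets and evaluation of the Kloosterman sum\<close>

definition coset_of :: "int \<Rightarrow> int \<Rightarrow> int \<times> int \<Rightarrow> (real ^ 2 ^ 2) set" where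
  "coset_of c uvbar = (\<lambda>(a, d). Gamma_inf_double_coset
     (twisted_mat (u * v) (a * uvbar) ((u * v * (a * uvbar) * d - 1) div c) c d))"

text \<open>The upper right entry in \<open>coset_of\<close> is the one forced by determinant one:
  the division is exact, as \<open>uvbar\<close> cancels \<open>u * v\<close> modulo
  \<open>c\<close>.\<close>

lemma det_coset_of:
  assumes "[u * v * uvbar = 1] (mod c)" "[a * d = 1] (mod c)"
  shows "u * v * (a * uvbar) * d - ((u * v * (a * uvbar) * d - 1) div c) * c = 1"
proof -
  have "[(u * v * uvbar) * (a * d) = 1 * 1] (mod c)"
    using assms by (rule cong_mult)
  then have "c dvd u * v * (a * uvbar) * d - 1"
    by (simp add: cong_iff_dvd_diff mult_ac)
  then show ?thesis
    by simp
qed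

lemma bij_betw_coset_of:
  assumes c: "c > 0" "[c = 0] (mod (p * q))" and uvbar: "[u * v * uvbar = 1] (mod c)"
  shows "bij_betw (coset_of c uvbar)
    {(a, d). a \<in> {0..<c} \<and> d \<in> {0..<c} \<and> [a * d = 1] (mod c)}
    (double_cosets_of_modulus (p * q * u * v) \<sigma>1 \<sigma>2 (of_int c * sqrt (of_int (u * v))))"
    (is "bij_betw _ ?P ?D")
  unfolding bij_betw_def
proof (intro conjI inj_onI subset_antisym subsetI)
  have uv: "u * v > 0"
    using pos by simp
  obtain c1 where c1: "c = p * q * c1"
    using c by (auto simp: cong_0_iff)
  {
    fix x y assume "x \<in> ?P" "y \<in> ?P" and eq: "coset_of c uvbar x = coset_of c uvbar y"
    then obtain a d a' d' where x: "x = (a, d)" and y: "y = (a', d')"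
      and P: "a \<in> {0..<c}" "d \<in> {0..<c}" "a' \<in> {0..<c}" "d' \<in> {0..<c}"
        "[a * d = 1] (mod c)" "[a' * d' = 1] (mod c)"
      by auto
    let ?b = "\<lambda>a d. (u * v * (a * uvbar) * d - 1) div c"
    have "twisted_mat (u * v) (a' * uvbar) (?b a' d') c d' \<in>
        Gamma_inf_double_coset (twisted_mat (u * v) (a * uvbar) (?b a d) c d)"
      using eq self_in_Gamma_inf_double_coset by (simp add: x y coset_of_def)
    then obtain i j b' where "twisted_mat (u * v) (a' * uvbar) (?b a' d') c d' =
        twisted_mat (u * v) (a * uvbar + i * c) b' c (d + j * c)"
      by (rule Gamma_inf_double_coset_twisted_matE [OF _ _ uv c(1) det_coset_of [OF uvbar P(5)]])
        (simp add: twisted_mat_def)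
    then have "real_of_int (a' * uvbar) = of_int (a * uvbar + i * c)"
      "real_of_int d' = of_int (d + j * c)"
      using pos unfolding twisted_mat_def mat2_eq_iff by auto
    then have eqs: "a' * uvbar = a * uvbar + i * c" "d' = d + j * c"
      by linarith+
    from eqs(2) have "[d' = d] (mod c)"
      by (simp add: cong_def)
    moreover have "[a' = a] (mod c)"
    proof -
      \<comment> \<open>\<open>u * v\<close> inverts \<open>uvbar\<close> modulo \<open>c\<close>,
        so \<open>uvbar\<close> may be cancelled.\<close>
      have cop: "coprime uvbar c"
        using uvbar by (metis coprime_iff_invertible_int mult.commute)
      have "[a' * uvbar = a * uvbar] (mod c)"
        using eqs(1) by (simp add: cong_def)
      with cop show ?thesis
        by (simp add: cong_mult_rcancel)
    qed
    ultimately show "x = y"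
      using P by (auto simp: x y cong_def)
  next
    fix D assume "D \<in> coset_of c uvbar ` ?P"
    then obtain a d where "[a * d = 1] (mod c)" and D: "D = coset_of c uvbar (a, d)"
      by auto
    note det = det_coset_of [OF uvbar this(1)]
    then have "twisted_mat (u * v) (a * uvbar) ((u * v * (a * uvbar) * d - 1) div c) c d
        \<in> conj_Gamma0 (p * q * u * v) \<sigma>1 \<sigma>2"
      unfolding conj_Gamma0_eq c1 by blast
    then show "D \<in> ?D"
      unfolding D coset_of_def double_cosets_of_modulus_def by (force simp: twisted_mat_def)
  next
    fix D assume "D \<in> ?D"
    then obtain a b c' d where det: "u * v * a * d - b * (p * q * c') = 1"
      and D: "D = Gamma_inf_double_coset (twisted_mat (u * v) a b (p * q * c') d)"
      and "twisted_mat (u * v) a b (p * q * c') d $ 2 $ 1 = c * sqrt (u * v)"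
      unfolding double_cosets_of_modulus_def conj_Gamma0_eq by blast
    then have "real_of_int (p * q * c') = real_of_int c"
      using pos by (simp add: twisted_mat_def)
    then have c': "p * q * c' = c"
      by linarith
    \<comment> \<open>The factor \<open>u * v\<close> compensates for the \<open>uvbar\<close> in
      \<open>coset_of\<close>: \<open>?a * uvbar\<close> is congruent to \<open>a\<close> modulo
      \<open>c\<close>.\<close>
    let ?a = "(u * v * a) mod c" and ?d = "d mod c"
    have "[u * v * a * d = 1] (mod c)"
    proof -
      have "u * v * a * d - 1 = b * c"
        using det by (simp add: c')
      then show ?thesis
        by (simp add: cong_iff_dvd_diff)
    qed
    then have ad: "[?a * ?d = 1] (mod c)"
      by (simp add: cong_def mod_simps)
    have "[(u * v * uvbar) * a = 1 * a] (mod c)"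
      using uvbar by (rule cong_scalar_right)
    then have "[?a * uvbar = a] (mod c)"
      by (simp add: cong_def mod_simps mult_ac)
    moreover have "[?d = d] (mod c)"
      by simp
    ultimately have "coset_of c uvbar (?a, ?d) = D"
      unfolding D coset_of_def c' prod.case
      using det c by (intro Gamma_inf_double_coset_twisted_mat_eq uv det_coset_of [OF uvbar ad])
        (auto simp: c')
    moreover have "(?a, ?d) \<in> ?P"
      using ad c by auto
    ultimately show "D \<in> coset_of c uvbar ` ?P"
      by blast
  }
qed

text \<open>\<open>M\<close> is any member of the coset with the prescribed lower left entry, so
  independence of the representative is part of the result. Each component of \<open>chi\<close> is
  evaluated by one congruence of \<open>lift_d_cong\<close>.\<close>

lemma kloosterman_term_coset_of:
  assumes chi: "dirichlet_character p chi_p" "dirichlet_character q chi_q"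
      "dirichlet_character u chi_u" "dirichlet_character v chi_v"
      "\<And>k. chi k = chi_p k * chi_q k * chi_u k * chi_v k"
    and c: "c > 0" "[c = 0] (mod (p * q))" "coprime c (u * v)"
    and uvbar: "[u * v * uvbar = 1] (mod c)"
    and ad: "[a * d = 1] (mod c)"
    and M: "M \<in> coset_of c uvbar (a, d)" "M $ 2 $ 1 = of_int c * sqrt (of_int (u * v))"
  shows "kloosterman_term \<sigma>1 \<sigma>2 chi m n M =
    f_factor p q u v chi_p chi_q chi_u chi_v * cnj (chi_u c) * chi_v c *
      (cnj (chi_p d) * cnj (chi_q a) * e (of_int (a * uvbar * m + d * n) / of_int c))"
proof -
  have uv: "u * v > 0"
    using pos by simp
  obtain c1 where c1: "c = p * q * c1"
    using c by (auto simp: cong_0_iff)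
  obtain i j b where M_eq: "M = twisted_mat (u * v) (a * uvbar + i * c) b c (d + j * c)"
    and det: "u * v * (a * uvbar + i * c) * (d + j * c) - b * c = 1"
    using Gamma_inf_double_coset_twisted_matE
      [OF M(1) [unfolded coset_of_def prod.case] M(2) uv c(1) det_coset_of [OF uvbar ad]] .
  define a' d' where "a' = a * uvbar + i * c" and "d' = d + j * c"
  note M_eq = M_eq [folded a'_def d'_def] and det = det [folded a'_def d'_def]
  let ?D = "lift_d a' b c1 d'"
  note cong = lift_d_cong [OF det [unfolded c1], folded c1]
  have "char_mat chi (\<sigma>1 ** M ** matrix_inv \<sigma>2) = chi ?D"
    unfolding M_eq c1 twisted_to_Gamma0 char_mat_def by simp
  moreover have "(M $ 1 $ 1 * of_int m + M $ 2 $ 2 * of_int n) / M $ 2 $ 1 = (a' * m + d' * n) / c"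
    using pos c(1) by (simp add: M_eq twisted_mat_def field_simps)
  moreover have "e ((a' * m + d' * n) / c) = e (of_int (a * uvbar * m + d * n) / of_int c)"
  proof (rule e_eq_if_diff_Ints)
    \<comment> \<open>Changing the representative shifts the phase by an integer.\<close>
    have "(a' * m + d' * n) / c - of_int (a * uvbar * m + d * n) / of_int c = real_of_int (i * m + j * n)"
      using c(1) by (simp add: a'_def d'_def field_simps)
    then show "(a' * m + d' * n) / c - of_int (a * uvbar * m + d * n) / of_int c \<in> \<int>"
      by (metis Ints_of_int)
  qed
  moreover have "cnj (chi_p ?D) = cnj (chi_p u) * cnj (chi_p d)"
  proof -
    have "[?D = u * d] (mod p)"
      using cong(1) by (rule cong_trans) (simp add: d'_def c1 cong_iff_dvd_diff algebra_simps)
    then show ?thesis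
      using dirichlet_character_cong [OF chi(1)] dirichlet_character_mult [OF chi(1)]
      by (metis complex_cnj_mult)
  qed
  moreover have "cnj (chi_q ?D) = chi_q v * cnj (chi_q a)"
  proof (rule cnj_dirichlet_character_eq [OF chi(2) pos(2)])
    \<comment> \<open>Multiplication by \<open>u * v\<close> removes \<open>uvbar\<close>; the
      congruence descends to \<open>q\<close>, which divides \<open>c\<close>.\<close>
    have "[u * v * a' = a] (mod c)"
    proof -
      have "[(u * v * uvbar) * a = 1 * a] (mod c)"
        using uvbar by (rule cong_scalar_right)
      then show ?thesis
        by (simp add: a'_def cong_def algebra_simps)
    qed
    then have "[u * v * a' = a] (mod q)"
      by (rule cong_dvd_modulus) (simp add: c1)
    with cong(2) show "[?D * v = a] (mod q)"
      by (rule cong_trans)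
    show "coprime v q"
      using coprime_factors by (simp add: coprime_commute)
  qed
  moreover have "cnj (chi_u ?D) = chi_u v * chi_u (p * q) * cnj (chi_u c)"
  proof -
    have "coprime (v * (p * q)) u"
      using coprime_factors by (simp add: ac_simps coprime_commute)
    from cnj_dirichlet_character_eq [OF chi(3) pos(3) this cong(3)] show ?thesis
      by (simp add: dirichlet_character_mult [OF chi(3)])
  qed
  moreover have "cnj (chi_v ?D) = chi_v c * (chi_v (- 1) * cnj (chi_v u) * cnj (chi_v (p * q)))"
  proof -
    have "coprime c v"
      using c(3) by simp
    from cnj_dirichlet_character_eq [OF chi(4) pos(4) this cong(4)] show ?thesis
      by (simp only: dirichlet_character_mult [OF chi(4)]
          cnj_dirichlet_character_minus_one [OF chi(4) pos(4)]
          complex_cnj_mult mult_ac)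
  qed
  ultimately show ?thesis
    by (simp add: kloosterman_term_def chi(5) f_factor_def)
qed

lemma kloosterman_sum_eq:
  assumes chi: "dirichlet_character p chi_p" "dirichlet_character q chi_q"
      "dirichlet_character u chi_u" "dirichlet_character v chi_v"
      "\<And>k. chi k = chi_p k * chi_q k * chi_u k * chi_v k"
    and c: "of_int c * sqrt (of_int (u * v)) \<in> allowed_moduli (p * q * u * v) \<sigma>1 \<sigma>2"
    and uvbar: "[u * v * uvbar = 1] (mod c)"
    and rep: "is_representative_system (p * q * u * v) \<sigma>1 \<sigma>2
      (of_int c * sqrt (of_int (u * v))) rep"
  shows "kloosterman_sum (p * q * u * v) \<sigma>1 \<sigma>2 rep m n (of_int c * sqrt (of_int (u * v))) chi =
    f_factor p q u v chi_p chi_q chi_u chi_v * cnj (chi_u c) * chi_v c *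
    (\<Sum>(a, d) \<in> {(a, d). a \<in> {0..<c} \<and> d \<in> {0..<c} \<and> [a * d = 1] (mod c)}.
       cnj (chi_p d) * cnj (chi_q a) * e (of_int (a * uvbar * m + d * n) / of_int c))"
proof -
  obtain c' :: int where c': "real_of_int c * sqrt (u * v) = c' * sqrt (u * v)"
      "real_of_int c * sqrt (u * v) > 0" "[c' = 0] (mod (p * q))" "coprime c' (u * v)"
    using c unfolding allowed_moduli_eq by blast
  have "c' = c"
    \<comment> \<open>Membership in the allowed moduli only yields some integer \<open>c'\<close>;
      cancelling the nonzero \<open>sqrt (u * v)\<close> identifies it with
      \<open>c\<close>.\<close>
    using c'(1) pos by simp
  moreover have "c > 0"
    using zero_less_mult_pos2 [OF c'(2)] pos by simp
  ultimately have c: "c > 0" "[c = 0] (mod (p * q))" "coprime c (u * v)"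
    using c' by auto
  let ?P = "{(a, d). a \<in> {0..<c} \<and> d \<in> {0..<c} \<and> [a * d = 1] (mod c)}"
  let ?\<gamma> = "of_int c * sqrt (of_int (u * v))"
  have bij: "bij_betw (coset_of c uvbar) ?P (double_cosets_of_modulus (p * q * u * v) \<sigma>1 \<sigma>2 ?\<gamma>)"
    using c uvbar by (intro bij_betw_coset_of)
  have "kloosterman_sum (p * q * u * v) \<sigma>1 \<sigma>2 rep m n ?\<gamma> chi =
      (\<Sum>x\<in>?P. kloosterman_term \<sigma>1 \<sigma>2 chi m n (rep (coset_of c uvbar x)))"
    \<comment> \<open>The sum over cosets becomes a sum over residue pairs, still with the arbitrary
      choice \<open>rep\<close>.\<close>
    unfolding kloosterman_sum_def using bij by (rule sum.reindex_bij_betw [symmetric])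
  also have "\<dots> = (\<Sum>(a, d)\<in>?P. f_factor p q u v chi_p chi_q chi_u chi_v * cnj (chi_u c) * chi_v c *
      (cnj (chi_p d) * cnj (chi_q a) * e (of_int (a * uvbar * m + d * n) / of_int c)))"
  proof (rule sum.cong [OF refl], clarify)
    fix a d assume "a \<in> {0..<c}" "d \<in> {0..<c}" and ad: "[a * d = 1] (mod c)"
    then have "coset_of c uvbar (a, d) \<in> double_cosets_of_modulus (p * q * u * v) \<sigma>1 \<sigma>2 ?\<gamma>"
      using bij_betwE [OF bij] by auto
    with rep have "rep (coset_of c uvbar (a, d)) \<in> coset_of c uvbar (a, d)"
      "rep (coset_of c uvbar (a, d)) $ 2 $ 1 = ?\<gamma>"
      by (auto simp: is_representative_system_def)
    with chi c uvbar ad show "kloosterman_term \<sigma>1 \<sigma>2 chi m n (rep (coset_of c uvbar (a, d))) =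
        f_factor p q u v chi_p chi_q chi_u chi_v * cnj (chi_u c) * chi_v c *
        (cnj (chi_p d) * cnj (chi_q a) * e (of_int (a * uvbar * m + d * n) / of_int c))"
      by (intro kloosterman_term_coset_of) auto
  qed
  finally show ?thesis
    by (simp only: sum_distrib_left case_prod_unfold)
qed

end

theorem theorem2p7:
  fixes N p q u v r1 s1 r2 s2 s1bar s2bar :: int
    and \<sigma>1 \<sigma>2 :: "real ^ 2 ^ 2"
  assumes "p > 0" "q > 0" "u > 0" "v > 0"
    and "coprime p q" "coprime p u" "coprime p v" "coprime q u" "coprime q v" "coprime u v"
    and "N = p * q * u * v"
    and "r1 = p * u" "s1 = q * v" "r2 = p * v" "s2 = q * u"
    and "[s1 * s1bar = 1] (mod r1)" "[s2 * s2bar = 1] (mod r2)"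
    and "\<sigma>1 = scaling_mat r1 s1 s1bar" "\<sigma>2 = scaling_mat r2 s2 s2bar"
  shows "allowed_moduli N \<sigma>1 \<sigma>2 =
           {\<gamma>. \<exists>c::int. \<gamma> = of_int c * sqrt (of_int (u * v)) \<and> \<gamma> > 0 \<and>
                  [c = 0] (mod (p * q)) \<and> coprime c (u * v)} \<and>
         (\<forall>chi chi_p chi_q chi_u chi_v.
            dirichlet_character N chi \<and> even_character chi \<and>
            dirichlet_character p chi_p \<and> dirichlet_character q chi_q \<and>
            dirichlet_character u chi_u \<and> dirichlet_character v chi_v \<and>
            (\<forall>k. chi k = chi_p k * chi_q k * chi_u k * chi_v k) \<longrightarrow>
            (\<forall>(m::int) (n::int) (c::int) (uvbar::int) rep.
               of_int c * sqrt (of_int (u * v)) \<in> allowed_moduli N \<sigma>1 \<sigma>2 \<and>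
               [u * v * uvbar = 1] (mod c) \<and>
               is_representative_system N \<sigma>1 \<sigma>2 (of_int c * sqrt (of_int (u * v))) rep \<longrightarrow>
               kloosterman_sum N \<sigma>1 \<sigma>2 rep m n (of_int c * sqrt (of_int (u * v))) chi =
               f_factor p q u v chi_p chi_q chi_u chi_v * cnj (chi_u c) * chi_v c *
               (\<Sum>(a, d) \<in> {(a, d). a \<in> {0..<c} \<and> d \<in> {0..<c} \<and> [a * d = 1] (mod c)}.
                  cnj (chi_p d) * cnj (chi_q a) *
                  e (of_int (a * uvbar * m + d * n) / of_int c))))"
proof -
  \<comment> \<open>The cofactors \<open>k1\<close> and \<open>k2\<close> turn the inverse
    congruences into the exact identities of the locale; they are the upper right entries of the two
    matrices \<open>tau_mat\<close>.\<close>
  obtain k1 where k1: "s1bar * (q * v) - 1 = p * u * k1"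
  proof -
    have "[s1bar * (q * v) = 1] (mod p * u)"
      using assms by (simp add: mult.commute)
    then show thesis
      using that by (auto simp: cong_iff_dvd_diff elim!: dvdE)
  qed
  obtain k2 where k2: "s2bar * (q * u) - 1 = p * v * k2"
  proof -
    have "[s2bar * (q * u) = 1] (mod p * v)"
      using assms by (simp add: mult.commute)
    then show thesis
      using that by (auto simp: cong_iff_dvd_diff elim!: dvdE)
  qed
  have pair: "atkin_lehner_pair p q u v s1bar s2bar k1 k2"
    using assms k1 k2 by unfold_locales
  note eqs = \<open>N = p * q * u * v\<close> \<open>\<sigma>1 = scaling_mat r1 s1 s1bar\<close> \<open>\<sigma>2 = scaling_mat r2 s2 s2bar\<close>
    \<open>r1 = p * u\<close> \<open>s1 = q * v\<close> \<open>r2 = p * v\<close> \<open>s2 = q * u\<close>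
  show ?thesis
    unfolding eqs using atkin_lehner_pair.allowed_moduli_eq [OF pair]
    by (intro conjI allI impI, simp only:, intro atkin_lehner_pair.kloosterman_sum_eq [OF pair]) blast+
qed

end
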